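(* Let $n\in\mathbb{N}$ and let $A\in M_n$. Then $d(\mathcal{K}_2(A))=n+\mathrm{nullity}(A)$.
   Context: $M_n$ is the set of $n\times n$ complex matrices. For $A\in M_n$, $\mathcal{K}_2(A)=\begin{bmatrix}0&A\\0&0\end{bmatrix}\in M_{2n}$. The zero-dilation index $d(X)$ of a square complex matrix $X$ is the largest integer $k$ such that $X$ is unitarily similar to a matrix of the form $\begin{bmatrix}0_k & *\\ * & *\end{bmatrix}$, where $0_k$ is the $k\times k$ zero matrix ($k=0$ if there is no such positive $k$). $\mathrm{nullity}(A)$ is the dimension of the kernel of $A$. *)

theory Defs
  imports
    "Jordan_Normal_Form.Schur_Decomposition"
    "Jordan_Normal_Form.Matrix_Kernel"
begin

definition unitary_mat :: "nat \<Rightarrow> complex mat \<Rightarrow> bool" where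
  "unitary_mat n U \<longleftrightarrow>
     U \<in> carrier_mat n n \<and> mat_adjoint U * U = 1\<^sub>m n \<and> U * mat_adjoint U = 1\<^sub>m n"

definition unitarily_similar :: "nat \<Rightarrow> complex mat \<Rightarrow> complex mat \<Rightarrow> bool" where
  "unitarily_similar n X Y \<longleftrightarrow>
     X \<in> carrier_mat n n \<and> Y \<in> carrier_mat n n \<and>
     (\<exists>U. unitary_mat n U \<and> Y = mat_adjoint U * X * U)"

definition zero_dilation :: "complex mat \<Rightarrow> nat \<Rightarrow> bool" where
  "zero_dilation X k \<longleftrightarrow>
     (\<exists>l B C D. B \<in> carrier_mat k l \<and> C \<in> carrier_mat l k \<and> D \<in> carrier_mat l l \<and>
        unitarily_similar (k + l) X (four_block_mat (0\<^sub>m k k) B C D))"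

text \<open>For square \<open>X\<close> the value \<open>k = 0\<close> is always admissible (the zero block is then empty)
  and \<open>k\<close> is bounded by the size of \<open>X\<close>, so the greatest element below exists, and it is 0
  exactly when no positive \<open>k\<close> is admissible; see the lemmas below.
  For non-square \<open>X\<close> the index is unspecified.\<close>

definition zero_dilation_index :: "complex mat \<Rightarrow> nat" where
  "zero_dilation_index X = (GREATEST k. zero_dilation X k)"

text \<open>The block matrix with \<open>A\<close> in the upper right corner and zeros elsewhere; meant for square \<open>A\<close>.\<close>

definition K2 :: "complex mat \<Rightarrow> complex mat" where
  "K2 A = (let n = dim_row A in four_block_mat (0\<^sub>m n n) A (0\<^sub>m n n) (0\<^sub>m n n))"

lemma mat_adjoint_one: "mat_adjoint (1\<^sub>m n) = (1\<^sub>m n :: complex mat)"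
  by (rule eq_matI) (auto simp: mat_adjoint_def mat_of_rows_def)

lemma zero_dilation_0:
  assumes X: "X \<in> carrier_mat m m"
  shows "zero_dilation X 0"
proof -
  have "four_block_mat (0\<^sub>m 0 0) (0\<^sub>m 0 m) (0\<^sub>m m 0) X = X"
    using X by (intro eq_matI) auto
  moreover have "unitary_mat m (1\<^sub>m m)"
    by (simp add: unitary_mat_def mat_adjoint_one)
  moreover have "X = mat_adjoint (1\<^sub>m m) * X * 1\<^sub>m m"
    using X by (simp add: mat_adjoint_one)
  ultimately have "unitarily_similar (0 + m) X (four_block_mat (0\<^sub>m 0 0) (0\<^sub>m 0 m) (0\<^sub>m m 0) X)"
    unfolding unitarily_similar_def using X by auto
  then show ?thesis
    unfolding zero_dilation_def using X zero_carrier_mat by blast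
qed

lemma zero_dilation_le:
  assumes "X \<in> carrier_mat m m" "zero_dilation X k"
  shows "k \<le> m"
  using assms by (auto simp: zero_dilation_def unitarily_similar_def)

lemma zero_dilation_index:
  assumes X: "X \<in> carrier_mat m m"
  shows "zero_dilation X (zero_dilation_index X)"
    and "zero_dilation X k \<Longrightarrow> k \<le> zero_dilation_index X"
  unfolding zero_dilation_index_def
  using GreatestI_nat[of "zero_dilation X", OF zero_dilation_0[OF X] zero_dilation_le[OF X]]
    Greatest_le_nat[of "zero_dilation X", OF _ zero_dilation_le[OF X]]
  by auto

end

theory Submission
  imports Defs
begin

text \<open>
  A zero block of size \<open>k\<close> is a \<open>k\<close>-dimensional subspace \<open>W\<close> with \<open>\<langle>K w, w'\<rangle> = 0\<close> on \<open>W\<close>, where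
  \<open>K = K\<^sub>2(A)\<close> acts by \<open>K (a, b) = (A b, 0)\<close>. The kernel of \<open>K\<close> is such a subspace and has dimension
  \<open>n + nullity A\<close>. Conversely, the vectors \<open>(A q, q)\<close> with \<open>q\<close> orthogonal to the kernel of \<open>A\<close> form a
  subspace of dimension \<open>n - nullity A\<close>, so if \<open>k > n + nullity A\<close>, it meets \<open>W\<close> in some \<open>w = (A q, q)\<close>
  with \<open>q \<noteq> 0\<close>. Then \<open>0 = \<langle>K w, w\<rangle> = \<parallel>A q\<parallel>\<^sup>2\<close>, so \<open>q\<close> lies in the kernel of \<open>A\<close> as well as in its
  orthogonal complement, a contradiction.
\<close>

section \<open>Homogeneous linear conditions and orthonormal families\<close>

text \<open>Fewer conditions than unknowns: padding the rows \<open>w i\<close> with zero rows gives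
  a singular square matrix, and \<open>x\<close> is a vector in its kernel. The product is bilinear,
  so Hermitian orthogonality is obtained by passing conjugated vectors.\<close>

lemma exists_nonzero_orthogonal:
  fixes w :: "nat \<Rightarrow> 'a :: field vec"
  assumes w: "\<And>i. i < p \<Longrightarrow> w i \<in> carrier_vec m" and "p < m"
  obtains x where "x \<in> carrier_vec m" "x \<noteq> 0\<^sub>v m" "\<And>i. i < p \<Longrightarrow> w i \<bullet> x = 0"
proof -
  define c where "c i = (if i < p then w i else 0\<^sub>v m)" for i
  \<comment> \<open>Row \<open>p\<close> of \<open>c\<close> is zero already; the explicit case
    split gives \<open>M\<close> the shape that \<open>det_row_0\<close> expects.\<close>
  define M where "M = mat\<^sub>r m m (\<lambda>i. if i = p then 0\<^sub>v m else c i)"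
  have c: "c i \<in> carrier_vec m" for i
    using w by (simp add: c_def)
  have M: "M \<in> carrier_mat m m"
    by (simp add: M_def)
  have "det M = 0"
    unfolding M_def using c by (intro det_row_0[OF \<open>p < m\<close>]) auto
  then obtain x where x: "x \<in> carrier_vec m" "x \<noteq> 0\<^sub>v m" "M *\<^sub>v x = 0\<^sub>v m"
    using det_0_iff_vec_prod_zero_field[OF M] by blast
  have "w i \<bullet> x = 0" if "i < p" for i
  proof -
    have "row M i = w i"
      using that \<open>p < m\<close> c[of i] w[of i] by (auto simp: M_def c_def)
    then have "w i \<bullet> x = (M *\<^sub>v x) $ i"
      using that \<open>p < m\<close> M by simp
    then show ?thesis
      using that \<open>p < m\<close> x by simp
  qed
  with x that show thesis by blast
qed

text \<open>An indexed family instead of a set: adding a vector is a function update at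
  \<open>k\<close>, and a family of length \<open>n\<close> can be read as the columns of a matrix.
  Values from index \<open>k\<close> on are unconstrained.\<close>

definition orthonormal :: "nat \<Rightarrow> (nat \<Rightarrow> complex vec) \<Rightarrow> nat \<Rightarrow> bool" where
  "orthonormal n f k \<longleftrightarrow>
     (\<forall>i<k. f i \<in> carrier_vec n) \<and> (\<forall>i<k. \<forall>j<k. f i \<bullet>c f j = (if i = j then 1 else 0))"

lemma orthonormal_carrier: "orthonormal n f k \<Longrightarrow> i < k \<Longrightarrow> f i \<in> carrier_vec n"
  by (simp add: orthonormal_def)

lemma orthonormal_cscalar_prod:
  "orthonormal n f k \<Longrightarrow> i < k \<Longrightarrow> j < k \<Longrightarrow> f i \<bullet>c f j = (if i = j then 1 else 0)"
  by (simp add: orthonormal_def)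

lemma cscalar_prod_sum:
  "x \<in> carrier_vec n \<Longrightarrow> y \<in> carrier_vec n \<Longrightarrow> x \<bullet>c y = (\<Sum>i<n. x $ i * cnj (y $ i))"
  by (auto simp: scalar_prod_def lessThan_atLeast0 intro!: sum.cong)

lemma cscalar_prod_cnj:
  fixes x y :: "complex vec"
  assumes "x \<in> carrier_vec n" "y \<in> carrier_vec n"
  shows "y \<bullet>c x = cnj (x \<bullet>c y)"
  using assms by (simp add: cscalar_prod_sum[of _ n] mult.commute)

text \<open>Only the normalisation of a Gram-Schmidt step remains, since \<open>x\<close> is
  orthogonal to the family from the start.\<close>

lemma orthonormal_extend:
  assumes f: "orthonormal n f k" and x: "x \<in> carrier_vec n" "x \<noteq> 0\<^sub>v n"
    and orth: "\<And>i. i < k \<Longrightarrow> x \<bullet>c f i = 0"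
  obtains a where "orthonormal n (f(k := a \<cdot>\<^sub>v x)) (Suc k)"
proof -
  define N where "N = (\<Sum>i<n. (cmod (x $ i))\<^sup>2)"
  have N: "x \<bullet>c x = of_real N"
    unfolding N_def of_real_sum complex_norm_square using x by (simp add: cscalar_prod_sum)
  have "N \<ge> 0"
    by (simp add: N_def sum_nonneg)
  moreover have "N \<noteq> 0"
    using N x conjugate_square_eq_0_vec[of x n] by auto
  ultimately have "N > 0" by simp
  \<comment> \<open>\<open>N\<close> is the squared norm of \<open>x\<close>, so \<open>a\<close> is
    the inverse of its norm.\<close>
  define a :: complex where "a = of_real (1 / sqrt N)"
  have "a * cnj a = of_real ((1 / sqrt N)\<^sup>2)"
    by (simp add: a_def power2_eq_square flip: of_real_mult)
  also have "\<dots> = of_real (1 / N)"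
    using \<open>N > 0\<close> by (simp add: power_divide)
  finally have a: "a * cnj a * of_real N = 1"
    using \<open>N > 0\<close> by simp
  have ax: "a \<cdot>\<^sub>v x \<in> carrier_vec n"
    using x by simp
  have "(a \<cdot>\<^sub>v x) \<bullet>c (a \<cdot>\<^sub>v x) = a * cnj a * (x \<bullet>c x)"
    using x by (simp add: cscalar_prod_sum[of _ n] sum_distrib_left algebra_simps)
  then have 1: "(a \<cdot>\<^sub>v x) \<bullet>c (a \<cdot>\<^sub>v x) = 1"
    using a N by simp
  have 2: "(a \<cdot>\<^sub>v x) \<bullet>c f i = 0" if "i < k" for i
  proof -
    have "(a \<cdot>\<^sub>v x) \<bullet>c f i = a * (x \<bullet>c f i)"
      using x orthonormal_carrier[OF f that]
      by (simp add: cscalar_prod_sum[of _ n] sum_distrib_left algebra_simps)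
    then show ?thesis using orth[OF that] by simp
  qed
  have 3: "f i \<bullet>c (a \<cdot>\<^sub>v x) = 0" if "i < k" for i
    using cscalar_prod_cnj[OF ax orthonormal_carrier[OF f that]] 2[OF that] by simp
  have "orthonormal n (f(k := a \<cdot>\<^sub>v x)) (Suc k)"
    using f ax 1 2 3 unfolding orthonormal_def by (auto simp: less_Suc_eq)
  then show thesis by (rule that)
qed

text \<open>More than \<open>n\<close> vectors in dimension \<open>n\<close> satisfy a nontrivial
  linear relation, and the inner product of that relation with each \<open>f l\<close> forces the
  coefficient at \<open>l\<close> to vanish.\<close>

lemma orthonormal_le:
  assumes f: "orthonormal n f k"
  shows "k \<le> n"
proof (rule ccontr)
  assume "\<not> k \<le> n"
  then have "n < k" by simp
  \<comment> \<open>The condition with index \<open>i\<close> says that coordinate \<open>i\<close>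
    of the sum of the vectors \<open>c $ j\<close> times \<open>f j\<close> is zero.\<close>
  obtain c where c: "c \<in> carrier_vec k" "c \<noteq> 0\<^sub>v k"
    "\<And>i. i < n \<Longrightarrow> vec k (\<lambda>j. f j $ i) \<bullet> c = 0"
    using exists_nonzero_orthogonal[of n "\<lambda>i. vec k (\<lambda>j. f j $ i)", OF _ \<open>n < k\<close>] by auto
  have "c $ l = 0" if l: "l < k" for l
  proof -
    have "c $ l = (\<Sum>j<k. c $ j * (f j \<bullet>c f l))"
      using l by (simp add: orthonormal_cscalar_prod[OF f] if_distrib cong: if_cong)
    also have "\<dots> = (\<Sum>j<k. c $ j * (\<Sum>i<n. f j $ i * cnj (f l $ i)))"
      using orthonormal_carrier[OF f] l
      by (intro sum.cong refl) (simp add: cscalar_prod_sum[of _ n])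
    also have "\<dots> = (\<Sum>i<n. (\<Sum>j<k. f j $ i * c $ j) * cnj (f l $ i))"
      by (simp add: sum_distrib_left sum_distrib_right, subst sum.swap, simp add: ac_simps)
    also have "\<dots> = 0"
    proof (intro sum.neutral ballI)
      fix i assume "i \<in> {..<n}"
      then have "(\<Sum>j<k. f j $ i * c $ j) = 0"
        using c(1) c(3)[of i] by (simp add: scalar_prod_def lessThan_atLeast0)
      then show "(\<Sum>j<k. f j $ i * c $ j) * cnj (f l $ i) = 0" by simp
    qed
    finally show ?thesis .
  qed
  then have "c = 0\<^sub>v k"
    using c(1) by (intro eq_vecI) auto
  with c show False by simp
qed

text \<open>As long as \<open>k < n\<close>, some nonzero vector is orthogonal to the family and
  extends it; the induction is on the number of missing vectors.\<close>

lemma orthonormal_complete: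
  assumes "orthonormal n f k"
  obtains g where "orthonormal n g n" "\<And>i. i < k \<Longrightarrow> g i = f i"
proof -
  have "\<exists>g. orthonormal n g n \<and> (\<forall>i<k. g i = f i)"
    using assms
  proof (induction "n - k" arbitrary: f k)
    case 0
    then show ?case using orthonormal_le[of n f k] by auto
  next
    case (Suc d)
    then have "k < n" by simp
    obtain x where x: "x \<in> carrier_vec n" "x \<noteq> 0\<^sub>v n"
      "\<And>i. i < k \<Longrightarrow> conjugate (f i) \<bullet> x = 0"
      using exists_nonzero_orthogonal[of k "\<lambda>i. conjugate (f i)", OF _ \<open>k < n\<close>]
        orthonormal_carrier[OF Suc.prems] by auto
    have "x \<bullet>c f i = 0" if "i < k" for i
      using x(3)[OF that] conjugate_vec_sprod_comm[OF x(1) orthonormal_carrier[OF Suc.prems that]]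
      by simp
    from orthonormal_extend[OF Suc.prems x(1,2) this] obtain a
      where a: "orthonormal n (f(k := a \<cdot>\<^sub>v x)) (Suc k)" .
    have "d = n - Suc k" using Suc.hyps by simp
    from Suc.hyps(1)[OF this a] show ?case by fastforce
  qed
  then show thesis using that by blast
qed

section \<open>Adjoints and unitary matrices\<close>

lemma mat_adjoint_index:
  "i < dim_col A \<Longrightarrow> j < dim_row A \<Longrightarrow> mat_adjoint A $$ (i, j) = conjugate (A $$ (j, i))"
  by (simp add: mat_adjoint_def mat_of_rows_def)

lemma mat_adjoint_carrier: "A \<in> carrier_mat r c \<Longrightarrow> mat_adjoint A \<in> carrier_mat c r"
  by (auto simp: mat_adjoint_def mat_of_rows_def)

lemma unitary_mat_orthonormal:
  assumes f: "orthonormal n f n"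
  shows "unitary_mat n (mat n n (\<lambda>(i, j). f j $ i))" (is "unitary_mat n ?U")
proof -
  have adj: "mat_adjoint ?U \<in> carrier_mat n n"
    by (rule mat_adjoint_carrier) simp
  have "mat_adjoint ?U * ?U = 1\<^sub>m n"
  proof (rule eq_matI)
    fix i j assume "i < dim_row (1\<^sub>m n :: complex mat)" "j < dim_col (1\<^sub>m n :: complex mat)"
    then have i: "i < n" and j: "j < n" by auto
    have "(mat_adjoint ?U * ?U) $$ (i, j) = (\<Sum>l<n. cnj (f i $ l) * f j $ l)"
      using i j adj by (simp add: scalar_prod_def lessThan_atLeast0 mat_adjoint_index)
    also have "\<dots> = f j \<bullet>c f i"
      using orthonormal_carrier[OF f] i j by (simp add: cscalar_prod_sum[of _ n] mult.commute)
    also have "\<dots> = 1\<^sub>m n $$ (i, j)"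
      using orthonormal_cscalar_prod[OF f] i j by auto
    finally show "(mat_adjoint ?U * ?U) $$ (i, j) = 1\<^sub>m n $$ (i, j)" .
  qed (use adj in auto)
  \<comment> \<open>A left inverse of a square matrix is also a right inverse.\<close>
  moreover from this have "?U * mat_adjoint ?U = 1\<^sub>m n"
    by (intro mat_mult_left_right_inverse[OF adj]) auto
  ultimately show ?thesis
    by (simp add: unitary_mat_def)
qed

lemma cscalar_prod_mat_adjoint:
  fixes A :: "complex mat"
  assumes A: "A \<in> carrier_mat r c" and x: "x \<in> carrier_vec r" and y: "y \<in> carrier_vec c"
  shows "(mat_adjoint A *\<^sub>v x) \<bullet>c y = x \<bullet>c (A *\<^sub>v y)"
proof -
  have *: "(mat_adjoint A *\<^sub>v x) $ i = (\<Sum>j<r. cnj (A $$ (j, i)) * x $ j)" if "i < c" for i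
    using that mat_adjoint_carrier[OF A] A x
    by (simp add: scalar_prod_def lessThan_atLeast0 mat_adjoint_index)
  have "(mat_adjoint A *\<^sub>v x) \<bullet>c y = (\<Sum>i<c. (mat_adjoint A *\<^sub>v x) $ i * cnj (y $ i))"
    using mat_adjoint_carrier[OF A] x y by (intro cscalar_prod_sum) auto
  also have "\<dots> = (\<Sum>i<c. (\<Sum>j<r. cnj (A $$ (j, i)) * x $ j) * cnj (y $ i))"
    using * by simp
  also have "\<dots> = (\<Sum>j<r. x $ j * cnj (\<Sum>i<c. A $$ (j, i) * y $ i))"
    by (simp add: sum_distrib_left sum_distrib_right, subst sum.swap, simp add: ac_simps)
  also have "\<dots> = x \<bullet>c (A *\<^sub>v y)"
    using A x y by (simp add: cscalar_prod_sum[of _ r] scalar_prod_def lessThan_atLeast0)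
  finally show ?thesis .
qed


section \<open>Orthonormal families in a kernel\<close>

text \<open>Complete the family to an orthonormal basis and take it as the columns of
  \<open>U\<close>. The first \<open>k\<close> columns of \<open>X * U\<close> are then
  zero.\<close>

lemma zero_dilation_orthonormal_kernel:
  assumes X: "X \<in> carrier_mat m m" and f: "orthonormal m f k"
    and ker: "\<And>i. i < k \<Longrightarrow> X *\<^sub>v f i = 0\<^sub>v m"
  shows "zero_dilation X k"
proof -
  obtain g where g: "orthonormal m g m" and gf: "\<And>i. i < k \<Longrightarrow> g i = f i"
    using orthonormal_complete[OF f] by blast
  define U where "U = mat m m (\<lambda>(i, j). g j $ i)"
  have unitary: "unitary_mat m U"
    unfolding U_def by (rule unitary_mat_orthonormal[OF g])
  then have U: "U \<in> carrier_mat m m" and UH: "mat_adjoint U \<in> carrier_mat m m"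
    by (auto simp: unitary_mat_def mat_adjoint_carrier)
  define Y where "Y = mat_adjoint U * X * U"
  have Y: "Y \<in> carrier_mat m m"
    using X U UH by (simp add: Y_def)
  have "k \<le> m"
    by (rule orthonormal_le[OF f])
  \<comment> \<open>The first \<open>k\<close> columns of \<open>Y\<close> vanish in full length,
    which covers the upper left block.\<close>
  have zero: "Y $$ (i, j) = 0" if "i < m" "j < k" for i j
  proof -
    have j: "j < m" using that \<open>k \<le> m\<close> by simp
    have "col U j = f j"
      using gf[OF \<open>j < k\<close>] orthonormal_carrier[OF g j] j by (auto simp: U_def)
    then have "col (X * U) j = 0\<^sub>v m"
      using ker[OF \<open>j < k\<close>] col_mult2[OF X U j] by simp
    moreover have "Y = mat_adjoint U * (X * U)"
      using UH X U by (simp add: Y_def)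
    ultimately show ?thesis
      using UH X U j \<open>i < m\<close> by simp
  qed
  obtain Y1 B C D where split: "split_block Y k k = (Y1, B, C, D)"
    by (cases "split_block Y k k")
  note sb = split_block[OF split, of "m - k" "m - k"]
  have dims: "dim_row Y = k + (m - k)" "dim_col Y = k + (m - k)"
    using Y \<open>k \<le> m\<close> by auto
  have "Y1 = 0\<^sub>m k k"
  proof (rule eq_matI)
    fix i j assume "i < dim_row (0\<^sub>m k k :: complex mat)" "j < dim_col (0\<^sub>m k k :: complex mat)"
    then have ij: "i < k" "j < k" by auto
    then have "Y $$ (i, j) = Y1 $$ (i, j)"
      using sb(1,4)[OF dims] by (subst sb(5)[OF dims]) auto
    then show "Y1 $$ (i, j) = 0\<^sub>m k k $$ (i, j)"
      using zero[of i j] ij \<open>k \<le> m\<close> by simp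
  qed (use sb(1)[OF dims] in auto)
  then have "Y = four_block_mat (0\<^sub>m k k) B C D"
    using sb(5)[OF dims] by simp
  moreover have "unitarily_similar (k + (m - k)) X Y"
    using X Y unitary \<open>k \<le> m\<close> by (auto simp: unitarily_similar_def Y_def)
  ultimately show ?thesis
    unfolding zero_dilation_def using sb(2-4)[OF dims] by blast
qed

text \<open>Orthonormality gives linear independence and maximality gives spanning, so the family is
  a basis of the kernel. This links the abstract \<open>kernel_dim\<close> to concrete
  families.\<close>

lemma maximal_orthonormal_kernel_dim:
  assumes A: "A \<in> carrier_mat r n" and f: "orthonormal n f s"
    and ker: "\<And>i. i < s \<Longrightarrow> A *\<^sub>v f i = 0\<^sub>v r"
    and max: "\<And>x. x \<in> carrier_vec n \<Longrightarrow> A *\<^sub>v x = 0\<^sub>v r \<Longrightarrow>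
      (\<And>i. i < s \<Longrightarrow> x \<bullet>c f i = 0) \<Longrightarrow> x = 0\<^sub>v n"
  shows "kernel_dim A = s"
proof -
  interpret kernel r n A by unfold_locales (rule A)
  define S where "S = f ` {..<s}"
  have inj: "inj_on f {..<s}"
  proof (rule inj_onI)
    fix i j assume "i \<in> {..<s}" "j \<in> {..<s}" "f i = f j"
    then show "i = j"
      using orthonormal_cscalar_prod[OF f, of i i] orthonormal_cscalar_prod[OF f, of i j]
      by (auto split: if_splits)
  qed
  have S: "S \<subseteq> mat_kernel A"
    using ker orthonormal_carrier[OF f] by (auto simp: S_def intro: mat_kernelI[OF A])
  have "finite S" by (simp add: S_def)
  \<comment> \<open>The coefficients of a linear combination are recovered as inner products.
    Independence follows at once, and so does the orthogonality of the residual \<open>v - w\<close>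
    below.\<close>
  have inner: "lincomb a S \<bullet>c f i = a (f i)" if i: "i < s" for a i
  proof -
    have fi: "f i \<in> carrier_vec n" by (rule orthonormal_carrier[OF f i])
    have lc: "lincomb a S \<in> carrier_vec n"
      using Ker.lincomb_closed[OF S, of a] mat_kernel_carrier[OF A] by auto
    have "lincomb a S \<bullet>c f i = (\<Sum>l<n. (\<Sum>x\<in>S. a x * x $ l) * cnj (f i $ l))"
      by (simp add: cscalar_prod_sum[OF lc fi] lincomb_index[OF _ S])
    also have "\<dots> = (\<Sum>x\<in>S. a x * (\<Sum>l<n. x $ l * cnj (f i $ l)))"
      by (simp add: sum_distrib_left sum_distrib_right, subst sum.swap, simp add: ac_simps)
    also have "\<dots> = (\<Sum>x\<in>S. a x * (x \<bullet>c f i))"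
      using S mat_kernel_carrier[OF A]
      by (intro sum.cong refl) (subst cscalar_prod_sum[OF _ fi], auto)
    also have "\<dots> = (\<Sum>j<s. a (f j) * (f j \<bullet>c f i))"
      unfolding S_def by (simp add: sum.reindex[OF inj])
    also have "\<dots> = a (f i)"
      using i by (simp add: orthonormal_cscalar_prod[OF f] if_distrib cong: if_cong)
    finally show ?thesis .
  qed
  have "lin_indpt S"
  proof (rule Ker.finite_lin_indpt2[OF \<open>finite S\<close> S])
    fix a :: "complex vec \<Rightarrow> complex" assume "lincomb a S = 0\<^sub>v n"
    then have "a (f i) = 0" if "i < s" for i
      using inner[OF that, of a] orthonormal_carrier[OF f that] by simp
    then show "\<forall>v\<in>S. a v = 0" by (auto simp: S_def)
  qed
  moreover have "mat_kernel A \<subseteq> span S"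
  proof
    fix v assume v: "v \<in> mat_kernel A"
    \<comment> \<open>\<open>w\<close> is the orthogonal projection of \<open>v\<close> onto the
      span of \<open>S\<close>.\<close>
    define w where "w = lincomb (\<lambda>x. v \<bullet>c x) S"
    have w: "w \<in> mat_kernel A"
      unfolding w_def by (rule Ker.lincomb_closed[OF S]) auto
    note vc = mat_kernelD[OF A v] and wc = mat_kernelD[OF A w]
    have "v - w = 0\<^sub>v n"
    proof (rule max)
      show "A *\<^sub>v (v - w) = 0\<^sub>v r"
        using vc wc by (simp add: mult_minus_distrib_mat_vec[OF A])
      fix i assume i: "i < s"
      have "(v - w) \<bullet>c f i = v \<bullet>c f i - w \<bullet>c f i"
        using vc(1) wc(1) orthonormal_carrier[OF f i]
        by (intro minus_scalar_prod_distrib) auto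
      then show "(v - w) \<bullet>c f i = 0"
        using inner[OF i] by (simp add: w_def)
    qed (use vc wc in auto)
    then have "v = w"
      using vc(1) wc(1) by (auto simp: vec_eq_iff)
    then show "v \<in> span S"
      unfolding w_def Ker.finite_span[OF \<open>finite S\<close> S] by auto
  qed
  ultimately have "basis S"
    using S Ker.span_is_subset2[OF S] by (auto simp: Ker.basis_def)
  then show ?thesis
    using Ker.dim_basis[OF \<open>finite S\<close>] by (simp add: S_def card_image[OF inj])
qed

text \<open>Take a longest orthonormal family in the kernel; its length is bounded by
  \<open>n\<close>. A nonzero kernel vector orthogonal to it would extend it. The last property says
  that the kernel meets its orthogonal complement only in zero.\<close>

lemma obtain_orthonormal_kernel_basis:
  assumes A: "A \<in> carrier_mat r n"
  obtains f where "orthonormal n f (kernel_dim A)"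
    "\<And>i. i < kernel_dim A \<Longrightarrow> A *\<^sub>v f i = 0\<^sub>v r"
    "\<And>x. x \<in> carrier_vec n \<Longrightarrow> A *\<^sub>v x = 0\<^sub>v r \<Longrightarrow>
      (\<And>i. i < kernel_dim A \<Longrightarrow> x \<bullet>c f i = 0) \<Longrightarrow> x = 0\<^sub>v n"
proof -
  define P where "P k \<longleftrightarrow> (\<exists>f. orthonormal n f k \<and> (\<forall>i<k. A *\<^sub>v f i = 0\<^sub>v r))" for k
  have bound: "k \<le> n" if "P k" for k
    using that orthonormal_le unfolding P_def by blast
  define s where "s = (GREATEST k. P k)"
  have "P 0" by (simp add: P_def orthonormal_def)
  then have "P s"
    unfolding s_def using bound by (rule GreatestI_nat)
  then obtain f where f: "orthonormal n f s" and ker: "\<And>i. i < s \<Longrightarrow> A *\<^sub>v f i = 0\<^sub>v r"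
    unfolding P_def by blast
  have max: "x = 0\<^sub>v n" if x: "x \<in> carrier_vec n" "A *\<^sub>v x = 0\<^sub>v r"
    and orth: "\<And>i. i < s \<Longrightarrow> x \<bullet>c f i = 0" for x
  proof (rule ccontr)
    assume "x \<noteq> 0\<^sub>v n"
    from orthonormal_extend[OF f x(1) this orth] obtain a
      where a: "orthonormal n (f(s := a \<cdot>\<^sub>v x)) (Suc s)" .
    have "A *\<^sub>v (a \<cdot>\<^sub>v x) = 0\<^sub>v r"
      using x by (auto simp: mult_mat_vec[OF A])
    then have "P (Suc s)"
      unfolding P_def using a ker
      by (intro exI[of _ "f(s := a \<cdot>\<^sub>v x)"]) (auto simp: less_Suc_eq)
    then have "Suc s \<le> s"
      unfolding s_def using bound by (rule Greatest_le_nat)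
    then show False by simp
  qed
  have "kernel_dim A = s"
    by (rule maximal_orthonormal_kernel_dim[OF A f ker max])
  with f ker max that show thesis by blast
qed

section \<open>The block matrix \<open>K2 A\<close> and the two bounds\<close>

lemma K2_carrier: "A \<in> carrier_mat n n \<Longrightarrow> K2 A \<in> carrier_mat (n + n) (n + n)"
  by (auto simp: K2_def Let_def)

lemma K2_mult_append:
  assumes A: "A \<in> carrier_mat n n" and a: "a \<in> carrier_vec n" and b: "b \<in> carrier_vec n"
  shows "K2 A *\<^sub>v (a @\<^sub>v b) = (A *\<^sub>v b) @\<^sub>v 0\<^sub>v n"
proof -
  have "K2 A *\<^sub>v (a @\<^sub>v b) = (0\<^sub>m n n *\<^sub>v a + A *\<^sub>v b) @\<^sub>v (0\<^sub>m n n *\<^sub>v a + 0\<^sub>m n n *\<^sub>v b)"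
    unfolding K2_def Let_def using A a b
    by (subst four_block_mat_mult_vec[of _ n n _ n _ n]) auto
  moreover have "0\<^sub>m n n *\<^sub>v a = 0\<^sub>v n" "0\<^sub>m n n *\<^sub>v b = 0\<^sub>v n"
    using a b by (auto intro!: eq_vecI)
  ultimately show ?thesis
    using A b by simp
qed

lemma cscalar_prod_append:
  fixes a b c d :: "complex vec"
  assumes "a \<in> carrier_vec n" "b \<in> carrier_vec m" "c \<in> carrier_vec n" "d \<in> carrier_vec m"
  shows "(a @\<^sub>v b) \<bullet>c (c @\<^sub>v d) = a \<bullet>c c + b \<bullet>c d"
proof -
  have "conjugate (c @\<^sub>v d) = conjugate c @\<^sub>v conjugate d"
    by (rule eq_vecI) auto
  then show ?thesis
    using assms by (simp add: scalar_prod_append[of _ n _ m])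
qed

text \<open>The vectors (e_i, 0) for all unit vectors e_i, together with (0, f_j) for an orthonormal
  basis f_j of the kernel of \<open>A\<close>, are orthonormal and are annihilated by
  \<open>K2 A\<close>.\<close>

lemma zero_dilation_K2_ge:
  assumes A: "A \<in> carrier_mat n n"
  shows "zero_dilation (K2 A) (n + kernel_dim A)"
proof -
  obtain f where f: "orthonormal n f (kernel_dim A)"
    and ker: "\<And>i. i < kernel_dim A \<Longrightarrow> A *\<^sub>v f i = 0\<^sub>v n"
    using obtain_orthonormal_kernel_basis[OF A] by blast
  define g where "g i = (if i < n then unit_vec n i @\<^sub>v 0\<^sub>v n else 0\<^sub>v n @\<^sub>v f (i - n))" for i
  have fc: "f (i - n) \<in> carrier_vec n" if "i < n + kernel_dim A" "\<not> i < n" for i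
    using that by (intro orthonormal_carrier[OF f]) auto
  have "orthonormal (n + n) g (n + kernel_dim A)"
    unfolding orthonormal_def
  proof (intro conjI allI impI)
    fix i assume i: "i < n + kernel_dim A"
    show "g i \<in> carrier_vec (n + n)"
      using fc[OF i] by (auto simp: g_def)
    fix j assume j: "j < n + kernel_dim A"
    have unit: "conjugate (unit_vec n j) = (unit_vec n j :: complex vec)"
      by (rule eq_vecI) (auto simp: unit_vec_def)
    show "g i \<bullet>c g j = (if i = j then 1 else 0)"
      using fc[OF i] fc[OF j] i j orthonormal_cscalar_prod[OF f, of "i - n" "j - n"]
      by (auto simp: g_def cscalar_prod_append[of _ n _ n] unit)
  qed
  moreover have "K2 A *\<^sub>v g i = 0\<^sub>v (n + n)" if "i < n + kernel_dim A" for i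
    using fc[OF that] ker[of "i - n"] that A
    by (auto simp: g_def K2_mult_append[OF A])
  ultimately show ?thesis
    using zero_dilation_orthonormal_kernel[OF K2_carrier[OF A]] by blast
qed


text \<open>Intersecting the two subspaces becomes a homogeneous linear system for \<open>q\<close>
  alone: \<open>l\<close> equations place (A q, q) in the subspace of the zero block, and
  \<open>s\<close> equations make \<open>q\<close> orthogonal to the kernel of
  \<open>A\<close>.\<close>

lemma zero_dilation_K2_le:
  assumes A: "A \<in> carrier_mat n n" and "zero_dilation (K2 A) k"
  shows "k \<le> n + kernel_dim A"
proof (rule ccontr)
  assume less: "\<not> k \<le> n + kernel_dim A"
  define s where "s = kernel_dim A"
  obtain l B C D U where B: "B \<in> carrier_mat k l" and C: "C \<in> carrier_mat l k"
    and D: "D \<in> carrier_mat l l" and K: "K2 A \<in> carrier_mat (k + l) (k + l)"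
    and "unitary_mat (k + l) U"
    and block: "four_block_mat (0\<^sub>m k k) B C D = mat_adjoint U * K2 A * U"
    using assms(2) unfolding zero_dilation_def unitarily_similar_def by blast
  then have U: "U \<in> carrier_mat (k + l) (k + l)"
    and UUH: "U * mat_adjoint U = 1\<^sub>m (k + l)"
    by (auto simp: unitary_mat_def)
  note UH = mat_adjoint_carrier[OF U]
  have kl: "k + l = n + n"
    using K K2_carrier[OF A] by auto
  obtain f where f: "orthonormal n f s"
    and max: "\<And>x. x \<in> carrier_vec n \<Longrightarrow> A *\<^sub>v x = 0\<^sub>v n \<Longrightarrow>
      (\<And>i. i < s \<Longrightarrow> x \<bullet>c f i = 0) \<Longrightarrow> x = 0\<^sub>v n"
    unfolding s_def using obtain_orthonormal_kernel_basis[OF A] by blast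
  \<comment> \<open>\<open>G\<close> sends \<open>q\<close> to the coordinates of (A q, q) in the
    orthonormal basis formed by the columns of \<open>U\<close>.\<close>
  define G where "G = mat_adjoint U * (A @\<^sub>r 1\<^sub>m n)"
  have A1: "A @\<^sub>r 1\<^sub>m n \<in> carrier_mat (k + l) n"
    using carrier_append_rows[OF A one_carrier_mat] kl by simp
  have G: "G \<in> carrier_mat (k + l) n"
    unfolding G_def using UH A1 by simp
  \<comment> \<open>The rows \<open>i < l\<close> put \<open>(A q, q)\<close> into the span of the first \<open>k\<close> columns of \<open>U\<close>;
    the others make \<open>q\<close> orthogonal to the kernel of \<open>A\<close>.\<close>
  define w where "w i = (if i < l then row G (k + i) else conjugate (f (i - l)))" for i
  \<comment> \<open>From \<open>k + l = n + n\<close> and \<open>k > n + s\<close>: there are fewer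
    equations than unknowns.\<close>
  have "l + s < n"
    using less kl by (simp add: s_def)
  have w: "w i \<in> carrier_vec n" if "i < l + s" for i
    using that G orthonormal_carrier[OF f, of "i - l"] by (auto simp: w_def)
  obtain q where q: "q \<in> carrier_vec n" "q \<noteq> 0\<^sub>v n" and wq: "\<And>i. i < l + s \<Longrightarrow> w i \<bullet> q = 0"
    using exists_nonzero_orthogonal[of "l + s" w n, OF w \<open>l + s < n\<close>] by blast
  have qf: "q \<bullet>c f i = 0" if "i < s" for i
    using wq[of "l + i"] that conjugate_vec_sprod_comm[OF q(1) orthonormal_carrier[OF f that]]
    by (simp add: w_def)
  define y where "y = G *\<^sub>v q"
  have y: "y \<in> carrier_vec (k + l)"
    using G q by (simp add: y_def)
  define c where "c = vec_first y k"
  have c: "c \<in> carrier_vec k"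
    by (simp add: c_def)
  \<comment> \<open>The first \<open>l\<close> equations say exactly that the last \<open>l\<close>
    coordinates of \<open>y\<close> are zero.\<close>
  have yc: "y = c @\<^sub>v 0\<^sub>v l"
  proof (rule eq_vecI)
    fix i assume "i < dim_vec (c @\<^sub>v 0\<^sub>v l)"
    then have i: "i < k + l" using c by simp
    have "y $ i = 0" if "\<not> i < k"
    proof -
      have "i - k < l" "k + (i - k) = i" using that i by auto
      then show ?thesis
        using wq[of "i - k"] i G q by (simp add: w_def y_def)
    qed
    then show "y $ i = (c @\<^sub>v 0\<^sub>v l) $ i"
      using i c by (auto simp: c_def vec_first_def)
  qed (use y c in auto)
  define Aq where "Aq = A *\<^sub>v q"
  have Aq: "Aq \<in> carrier_vec n"
    using A q by (simp add: Aq_def)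
  define z where "z = Aq @\<^sub>v q"
  have z: "z \<in> carrier_vec (k + l)"
    using Aq q kl by (simp add: z_def)
  have "z = (A @\<^sub>r 1\<^sub>m n) *\<^sub>v q"
    unfolding z_def Aq_def using q by (subst mat_mult_append[OF A one_carrier_mat]) auto
  then have "y = mat_adjoint U *\<^sub>v z"
    unfolding y_def G_def using UH A1 q by simp
  then have "U *\<^sub>v y = (U * mat_adjoint U) *\<^sub>v z"
    using U UH z by simp
  then have Uy: "U *\<^sub>v y = z"
    using UUH z by simp
  \<comment> \<open>Since \<open>K2 A\<close> maps (A q, q) to (A q, 0), its quadratic form at
    \<open>z\<close> is the squared norm of \<open>Aq\<close>. In the coordinates \<open>y\<close>
    it is the form of the block matrix, and a vector (c, 0) meets only the zero block.\<close>
  have "Aq \<bullet>c Aq = (K2 A *\<^sub>v z) \<bullet>c z"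
    unfolding z_def using A q Aq
    by (simp add: K2_mult_append cscalar_prod_append[of _ n _ n] flip: Aq_def)
  also have "\<dots> = (mat_adjoint U *\<^sub>v (K2 A *\<^sub>v (U *\<^sub>v y))) \<bullet>c y"
    using cscalar_prod_mat_adjoint[OF U _ y, of "K2 A *\<^sub>v z"] K z Uy by simp
  also have "mat_adjoint U *\<^sub>v (K2 A *\<^sub>v (U *\<^sub>v y)) = four_block_mat (0\<^sub>m k k) B C D *\<^sub>v y"
    unfolding block using U UH K y by (simp add: assoc_mult_mat_vec[of _ "k + l" "k + l" _ "k + l"])
  also have "\<dots> = (0\<^sub>m k k *\<^sub>v c + B *\<^sub>v 0\<^sub>v l) @\<^sub>v (C *\<^sub>v c + D *\<^sub>v 0\<^sub>v l)"
    unfolding yc using B C D c by (intro four_block_mat_mult_vec) auto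
  also have "0\<^sub>m k k *\<^sub>v c + B *\<^sub>v 0\<^sub>v l = 0\<^sub>v k"
    using B c by (auto intro!: eq_vecI)
  also have "(0\<^sub>v k @\<^sub>v (C *\<^sub>v c + D *\<^sub>v 0\<^sub>v l)) \<bullet>c y = 0"
    unfolding yc using C D c by (simp add: cscalar_prod_append[of _ k _ l])
  finally have "Aq = 0\<^sub>v n"
    using Aq by simp
  with max[OF q(1)] qf q(2) show False
    by (simp add: Aq_def)
qed

theorem theorem4p12:
  fixes n :: nat and A :: "complex mat"
  assumes "A \<in> carrier_mat n n"
  shows "zero_dilation_index (K2 A) = n + kernel_dim A"
  using zero_dilation_index[OF K2_carrier[OF assms]] zero_dilation_K2_ge[OF assms]
    zero_dilation_K2_le[OF assms]
  by (meson le_antisym)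

end
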